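(* Let $f:(0,\infty)\to(0,\infty)$ be a differentiable function with $f(x)<x$ for all $x\in(0,\infty)$, and suppose that $f$ (extended by $f(0)=0$) is real analytic on a neighborhood of the origin. Suppose that for some $a,k\in(0,\infty)$ the limit $$\lim_{x\to 0}\frac{x^a-f(x)^a}{x^a f(x)^a}$$ exists and equals $\frac{1}{k^a}$. Let $(x_n)_{n\ge 0}$ be a sequence with $x_n>0$ and $x_{n+1}=f(x_n)$ for all $n$, and $\lim_{n\to\infty}x_n=0$. Then the series $\sum_{n=0}^{\infty}x_n=\sum_{n=0}^{\infty}f^n(x_0)$ is divergent.
   Context: $f^n$ in the series denotes the $n$-fold composition of $f$ with itself, $f^0=\operatorname{Id}$, whereas $f(x)^a$ denotes the $a$-th power of the real number $f(x)$. The limit is taken as $x\to0$ through positive values. That $f$ is real analytic on a neighborhood of the origin means that, for some $\delta>0$, $f(x)$ is given for $0\le x<\delta$ by a power series in $x$ centered at $0$ that converges on $(-\delta,\delta)$ (with $f(0)=0$). *)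

theory Defs
  imports Complex_Main "HOL-Analysis.Analysis"
begin

(* Only the values of g on [0, d) are constrained: g is meant for functions on [0, infinity).
   The power series itself is still required to converge on both sides of the origin. *)
definition real_analytic_at_origin :: "(real \<Rightarrow> real) \<Rightarrow> bool" where
  "real_analytic_at_origin g \<longleftrightarrow>
     (\<exists>d > 0. \<exists>c :: nat \<Rightarrow> real.
        (\<forall>x. - d < x \<and> x < d \<longrightarrow> summable (\<lambda>n. c n * x ^ n)) \<and>
        (\<forall>x. 0 \<le> x \<and> x < d \<longrightarrow> (\<lambda>n. c n * x ^ n) sums g x))"

end

theory Submission
  imports Defs
begin

text \<open>
  The orbit cannot decay faster than a constant times \<open>1/n\<close>, so its sum diverges by comparison
  with the harmonic series.

  The limit hypothesis says that \<open>1 / f(t)^a - 1 / t^a\<close> stays bounded near the origin. Multiplying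
  by \<open>t^a\<close> gives \<open>(t / f(t))^a \<rightarrow> 1\<close>, so \<open>f(t) / t \<rightarrow> 1\<close> (lemma \<open>ratio_tendsto_1\<close>). Analyticity then
  enters through the second-order remainder only: the linear coefficient of \<open>f\<close> must be 1, and hence
  \<open>f(t) \<ge> t - C t^2\<close> for small \<open>t > 0\<close> (lemmas \<open>real_analytic_at_origin_expansion\<close> and
  \<open>quadratic_lower_bound\<close>). In terms of reciprocals this is
  \<open>1 / x (n + 1) \<le> 1 / x n + 2 C\<close> for all large \<open>n\<close>, so \<open>1 / x n\<close> grows at most linearly
  (lemma \<open>not_summable_of_quadratic_decrement\<close>).

  The classical alternative determines the exact asymptotics: writing \<open>f(t) = t - c t^m + ...\<close>
  with \<open>m \<ge> 2\<close> forces \<open>a = m - 1 \<ge> 1\<close>, and then \<open>x n\<close> is asymptotic to \<open>k n^(-1/a)\<close>. The one-sided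
  bound above retains just what divergence requires.
\<close>

text \<open>
  Splitting off two terms of the power series leaves \<open>t^2\<close> times another convergent power series,
  which is continuous and so bounded near the origin.
\<close>

lemma real_analytic_at_origin_expansion:
  assumes "real_analytic_at_origin g" and "g 0 = 0"
  shows "\<exists>b. \<exists>C>0. \<forall>\<^sub>F t in at_right 0. \<bar>g t - b * t\<bar> \<le> C * t\<^sup>2"
proof -
  obtain d c where d: "0 < d"
    and S: "\<forall>x. - d < x \<and> x < d \<longrightarrow> summable (\<lambda>n. c n * x ^ n)"
      "\<forall>x. 0 \<le> x \<and> x < d \<longrightarrow> (\<lambda>n. c n * x ^ n) sums g x"
    using assms(1) unfolding real_analytic_at_origin_def by (elim exE conjE)
  have summ: "summable (\<lambda>n. c n * t ^ n)" if "- d < t" "t < d" for t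
    using S(1) that by blast
  have sums: "(\<lambda>n. c n * t ^ n) sums g t" if "0 \<le> t" "t < d" for t
    using S(2) that by blast
  have c0: "c 0 = 0"
    using iffD1[OF powser_sums_zero_iff sums[OF order_refl d]] assms(2) by simp
  define h where "h t = (\<Sum>n. c (Suc (Suc n)) * t ^ n)" for t
  have summ1: "summable (\<lambda>n. c (Suc n) * t ^ n)" if "- d < t" "t < d" for t
    using iffD2[OF summable_powser_split_head summ[OF that]] .
  have summ2: "summable (\<lambda>n. c (Suc (Suc n)) * t ^ n)" if "- d < t" "t < d" for t
    using iffD2[OF summable_powser_split_head[of "\<lambda>n. c (Suc n)"] summ1[OF that]] .
  have g: "g t - c 1 * t = h t * t\<^sup>2" if "0 \<le> t" "t < d" for t
  proof -
    have t: "- d < t" using that d by simp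
    have "g t = (\<Sum>n. c n * t ^ n)"
      using sums_unique[OF sums[OF that]] .
    also have "\<dots> = (\<Sum>n. c (Suc n) * t ^ n) * t"
      using powser_split_head(1)[OF summ[OF t that(2)]] c0 by simp
    also have "(\<Sum>n. c (Suc n) * t ^ n) = c 1 + h t * t"
      unfolding h_def using powser_split_head(1)[OF summ1[OF t that(2)]] by simp
    finally show ?thesis by (simp add: algebra_simps power2_eq_square)
  qed
  have "isCont h 0"
    unfolding h_def
    by (rule isCont_powser[where K = "d/2"]) (use summ2[of "d/2"] d in auto)
  then have "(h \<longlongrightarrow> h 0) (at_right 0)"
    unfolding isCont_def by (rule tendsto_mono[OF at_le, rotated]) simp
  then have "((\<lambda>t. \<bar>h t\<bar>) \<longlongrightarrow> \<bar>h 0\<bar>) (at_right 0)"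
    by (rule tendsto_rabs)
  then have "\<forall>\<^sub>F t in at_right 0. \<bar>h t\<bar> < \<bar>h 0\<bar> + 1"
    by (rule order_tendstoD) simp
  moreover have "\<forall>\<^sub>F t in at_right 0. t < d"
    using order_tendstoD(2)[OF tendsto_ident_at d] .
  ultimately have "\<forall>\<^sub>F t in at_right 0. \<bar>g t - c 1 * t\<bar> \<le> (\<bar>h 0\<bar> + 1) * t\<^sup>2"
    using eventually_at_right_less[of "0::real"]
  proof eventually_elim
    case (elim t)
    have "\<bar>g t - c 1 * t\<bar> = \<bar>h t\<bar> * t\<^sup>2"
      using g[of t] elim by (simp add: abs_mult)
    also have "\<dots> \<le> (\<bar>h 0\<bar> + 1) * t\<^sup>2"
      using elim by (intro mult_right_mono) auto
    finally show ?case .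
  qed
  then show ?thesis
    by (intro exI[of _ "c 1"] exI[of _ "\<bar>h 0\<bar> + 1"]) auto
qed

text \<open>
  Multiplied by \<open>t powr a\<close>, which tends to 0, the given quotient becomes
  \<open>(t / f t) powr a - 1\<close>, which therefore tends to \<open>0 * L = 0\<close>; raising
  \<open>(t / f t) powr a\<close> to the power \<open>- 1 / a\<close> recovers \<open>f t / t\<close>.
\<close>

lemma ratio_tendsto_1:
  fixes f :: "real \<Rightarrow> real"
  assumes pos: "\<And>t. 0 < t \<Longrightarrow> 0 < f t" and a: "0 < a"
    and lim: "((\<lambda>t. (t powr a - f t powr a) / (t powr a * f t powr a)) \<longlongrightarrow> L) (at_right 0)"
  shows "((\<lambda>t. f t / t) \<longlongrightarrow> 1) (at_right 0)"
proof -
  let ?q = "\<lambda>t. (t powr a - f t powr a) / (t powr a * f t powr a)"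
  have "\<forall>\<^sub>F t in at_right 0. 0 \<le> (t::real)"
    using eventually_at_right_less[of "0::real"] by eventually_elim simp
  then have "((\<lambda>t::real. t powr a) \<longlongrightarrow> 0 powr a) (at_right 0)"
    using a by (intro tendsto_powr' tendsto_ident_at tendsto_const) simp
  from tendsto_add[OF tendsto_const tendsto_mult[OF this lim]]
  have "((\<lambda>t. 1 + t powr a * ?q t) \<longlongrightarrow> 1 + 0 powr a * L) (at_right 0)" .
  then have "((\<lambda>t. (1 + t powr a * ?q t) powr (- (1 / a)))
      \<longlongrightarrow> (1 + 0 powr a * L) powr (- (1 / a))) (at_right 0)"
    by (intro tendsto_powr tendsto_const) auto
  moreover have "\<forall>\<^sub>F t in at_right 0. (1 + t powr a * ?q t) powr (- (1 / a)) = f t / t"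
    using eventually_at_right_less[of "0::real"]
  proof eventually_elim
    case (elim t)
    have ft: "0 < f t" using pos elim by simp
    have "1 + t powr a * ?q t = t powr a / f t powr a"
      using elim ft by (simp add: field_simps)
    also have "\<dots> = (f t / t) powr (- a)"
      using elim ft by (simp add: powr_divide powr_minus_divide)
    finally show ?case
      using a elim ft by (simp add: powr_powr)
  qed
  ultimately have "((\<lambda>t. f t / t) \<longlongrightarrow> (1 + 0 powr a * L) powr (- (1 / a))) (at_right 0)"
    by (rule Lim_transform_eventually)
  then show ?thesis by simp
qed

text \<open>
  The linear coefficient \<open>b\<close> of the expansion is the limit of \<open>f t / t\<close>, hence 1, and the lower half
  of the remainder estimate remains.
\<close>

lemma quadratic_lower_bound:
  fixes f :: "real \<Rightarrow> real"
  assumes analytic: "real_analytic_at_origin (f(0 := 0))"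
    and ratio: "((\<lambda>t. f t / t) \<longlongrightarrow> 1) (at_right 0)"
  shows "\<exists>C>0. \<forall>\<^sub>F t in at_right 0. t - C * t\<^sup>2 \<le> f t"
proof -
  obtain b C where C: "0 < C"
    and expansion: "\<forall>\<^sub>F t in at_right 0. \<bar>(f(0 := 0)) t - b * t\<bar> \<le> C * t\<^sup>2"
    using real_analytic_at_origin_expansion[OF analytic] by auto
  have bound: "\<forall>\<^sub>F t in at_right 0. \<bar>f t - b * t\<bar> \<le> C * t\<^sup>2"
    using expansion eventually_at_right_less[of "0::real"] by eventually_elim simp
  have "((\<lambda>t. f t / t - b) \<longlongrightarrow> 0) (at_right 0)"
  proof (rule Lim_null_comparison)
    show "\<forall>\<^sub>F t in at_right 0. norm (f t / t - b) \<le> C * t"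
      using bound eventually_at_right_less[of "0::real"]
    proof eventually_elim
      case (elim t)
      have "f t / t - b = (f t - b * t) / t"
        using elim by (simp add: field_simps)
      then have "\<bar>f t / t - b\<bar> = \<bar>f t - b * t\<bar> / t"
        using elim by simp
      also have "\<dots> \<le> C * t"
        using elim by (simp add: divide_le_eq power2_eq_square mult.assoc)
      finally show ?case by simp
    qed
    show "((\<lambda>t. C * t) \<longlongrightarrow> 0) (at_right 0)"
      by (auto intro!: tendsto_eq_intros)
  qed
  moreover have "((\<lambda>t. f t / t - b) \<longlongrightarrow> 1 - b) (at_right 0)"
    by (intro tendsto_intros ratio)
  ultimately have "b = 1"
    using tendsto_unique[OF trivial_limit_at_right_real] by fastforce
  with bound have "\<forall>\<^sub>F t in at_right 0. t - C * t\<^sup>2 \<le> f t"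
    by (auto elim: eventually_mono)
  with C show ?thesis by blast
qed

text \<open>
  The recursion \<open>u \<mapsto> u - C u^2\<close> is linearised by passing to reciprocals: each step adds to
  \<open>1 / u\<close> an amount close to \<open>C\<close> for small \<open>u\<close>. The factor 2 leaves room for the error, since
  \<open>1 / (1 - s) \<le> 1 + 2 * s\<close> for \<open>s = C * u\<close> between 0 and \<open>1 / 2\<close>.
\<close>

lemma inverse_quadratic_decrement:
  fixes u v C :: real
  assumes "0 < u" "0 < v" "0 \<le> C" "C * u \<le> 1 / 2" "u - C * u\<^sup>2 \<le> v"
  shows "1 / v \<le> 1 / u + 2 * C"
proof -
  have "0 \<le> C * u * (1 - 2 * (C * u))"
    using assms by simp
  then have "1 \<le> (1 - C * u) * (1 + 2 * (C * u))"
    by (simp add: algebra_simps)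
  then have "u \<le> u * ((1 - C * u) * (1 + 2 * (C * u)))"
    using assms(1) mult_left_mono[of 1 _ u] by simp
  also have "\<dots> = (u - C * u\<^sup>2) * (1 + 2 * (C * u))"
    by (simp add: algebra_simps power2_eq_square)
  also have "\<dots> \<le> v * (1 + 2 * (C * u))"
    using assms by (intro mult_right_mono) auto
  finally show ?thesis
    using assms(1,2) by (simp add: field_simps)
qed

text \<open>
  Iterating the previous bound, \<open>1 / x n\<close> grows at most linearly in \<open>n\<close>, so a tail of \<open>x\<close>
  dominates a multiple of the harmonic series.
\<close>

lemma not_summable_of_quadratic_decrement:
  fixes x :: "nat \<Rightarrow> real"
  assumes pos: "\<And>n. 0 < x n" and lim: "x \<longlonglongrightarrow> 0" and C: "0 \<le> C"
    and dec: "\<forall>\<^sub>F n in sequentially. x n - C * (x n)\<^sup>2 \<le> x (Suc n)"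
  shows "\<not> summable x"
proof
  assume summable: "summable x"
  have "(\<lambda>n. C * x n) \<longlonglongrightarrow> 0"
    using tendsto_mult_right_zero[OF lim] .
  then have "\<forall>\<^sub>F n in sequentially. C * x n < 1 / 2"
    by (rule order_tendstoD) simp
  with dec have "\<forall>\<^sub>F n in sequentially. 1 / x (Suc n) \<le> 1 / x n + 2 * C"
    by eventually_elim (rule inverse_quadratic_decrement, use pos C in auto)
  then obtain N where step: "1 / x (Suc n) \<le> 1 / x n + 2 * C" if "N \<le> n" for n
    unfolding eventually_sequentially by blast
  have linear: "1 / x (n + N) \<le> 1 / x N + 2 * C * real n" for n
  proof (induction n)
    case (Suc n)
    then show ?case using step[of "n + N"] by (simp add: algebra_simps)
  qed simp
  \<comment> \<open>One constant that absorbs both the initial value and the slope, so that the comparison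
    is with the harmonic series itself.\<close>
  define B where "B = 1 / x N + 2 * C"
  have B: "0 < B" using pos[of N] C by (simp add: B_def add_pos_nonneg)
  have harmonic_le: "1 / real (Suc n) \<le> B * x (n + N)" for n
  proof -
    have "1 / x (n + N) \<le> 1 / x N + 2 * C * real n" by (rule linear)
    also have "\<dots> \<le> B * real (Suc n)"
      using mult_nonneg_nonneg[of "1 / x N" "real n"] pos[of N] C
      by (simp add: B_def distrib_left distrib_right)
    finally show ?thesis
      using pos[of "n + N"] by (simp add: field_simps)
  qed
  have "summable (\<lambda>n. B * x (n + N))"
    using summable by (intro summable_mult) simp
  then have "summable (\<lambda>n. 1 / real (Suc n))"
  proof (rule summable_comparison_test')
    show "norm (1 / real (Suc n)) \<le> B * x (n + N)" for n
      using harmonic_le[of n] by simp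
  qed
  then show False
    using not_summable_harmonic[where ?'a = real]
    unfolding summable_Suc_iff[of "\<lambda>n. 1 / real n"] inverse_eq_divide by blast
qed

theorem theorem2p3:
  fixes f :: "real \<Rightarrow> real" and a k :: real and x :: "nat \<Rightarrow> real"
  assumes "\<And>t. 0 < t \<Longrightarrow> 0 < f t"
    and "f differentiable_on {0<..}"
    and "\<And>t. 0 < t \<Longrightarrow> f t < t"
    and "real_analytic_at_origin (f(0 := 0))"
    and "0 < a" and "0 < k"
    and "((\<lambda>t. (t powr a - f t powr a) / (t powr a * f t powr a)) \<longlongrightarrow> 1 / k powr a) (at_right 0)"
    and "\<And>n. 0 < x n"
    and "\<And>n. x (Suc n) = f (x n)"
    and "x \<longlonglongrightarrow> 0"
  shows "(\<forall>n. x n = (f ^^ n) (x 0)) \<and> \<not> summable x"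
proof
  show "\<forall>n. x n = (f ^^ n) (x 0)"
  proof
    show "x n = (f ^^ n) (x 0)" for n
      by (induction n) (simp_all add: assms(9))
  qed
  obtain C where C: "0 < C" and bound: "\<forall>\<^sub>F t in at_right 0. t - C * t\<^sup>2 \<le> f t"
    using quadratic_lower_bound[OF assms(4) ratio_tendsto_1[OF assms(1,5,7)]] by blast
  have "filterlim x (at_right 0) sequentially"
    using tendsto_imp_filterlim_at_right[OF assms(10)] assms(8) by simp
  from eventually_compose_filterlim[OF bound this]
  have "\<forall>\<^sub>F n in sequentially. x n - C * (x n)\<^sup>2 \<le> x (Suc n)"
    unfolding assms(9) .
  then show "\<not> summable x"
    by (rule not_summable_of_quadratic_decrement[OF assms(8,10) less_imp_le[OF C]])
qed

end
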